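(* In the deterministic optimal control problem under a parameterized policy, let $\pi=(\theta_0^*,\dots,\theta_{n-1}^* )\in\Theta^n$ be a stationary point of DP, and let $(x_0^*,\dots,x_n^* )$ be the corresponding state sequence, i.e. $x_0^*=x_0$, $x_{k+1}^*=f_k(x_k^*,\mu_{\theta_k^*}(x_k^* ))$. If for every $k\in\{0,\dots,n-1\}$, $\mu_{\theta_k}(x_k)$ is continuously differentiable with respect to $\theta_k$ in a neighborhood of $(x_k^*,\theta_k^* )$, then $\pi$ is also a stationary point of the one-shot optimization.
   Context: Setting (deterministic, parameterized policy): horizon $n$, states in $\mathbb{R}^N$, compact action space $A\subseteq\mathbb{R}^M$, dynamics $f_k:\mathbb{R}^N\times\mathbb{R}^M\to\mathbb{R}^N$ and stage costs $c_k:\mathbb{R}^N\times\mathbb{R}^M\to\mathbb{R}$ ($k=0,\dots,n-1$), terminal cost $c_n:\mathbb{R}^N\to\mathbb{R}$, all at least twice continuously differentiable; the initial state $x_0$ is given. $\Theta$ is a parameter space (a subset of a Euclidean space), and for each $\theta\in\Theta$, $\mu_\theta:\mathbb{R}^N\to A$ is a bounded function, such that for all $\epsilon>0$ there is $\delta>0$ with: $\|\theta-\theta'\|<\delta\Rightarrow\sup_{x\in\mathbb{R}^N}\|\mu_\theta(x)-\mu_{\theta'}(x)\|<\epsilon$. For a control policy parameter vector $\pi=(\theta_0,\dots,\theta_{n-1})\in\Theta^n$, define backward $J_n^\pi(x)=c_n(x)$, $Q_k^\pi(x,u)=c_k(x,u)+J_{k+1}^\pi(f_k(x,u))$, $J_k^\pi(x)=Q_k^\pi(x,\mu_{\theta_k}(x))$,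 $k=n-1,\dots,0$. The one-shot optimization is $\min_{\pi\in\Theta^n}J_0^\pi(x_0)$. Normal cone: for a set $S$ and $s^*\in S$, $\mathcal{N}_S(s^* )$ denotes the normal cone of $S$ at $s^*$, i.e. the set of $v$ with $\langle v,s-s^*\rangle\le o(\|s-s^*\|)$ for $s\in S$, $s\to s^*$. Stationary point of the one-shot optimization: $\pi=(\theta_0^*,\dots,\theta_{n-1}^* )\in\Theta^n$ with $-\nabla_{\theta_k}J_0^\pi(x_0)\in\mathcal{N}_\Theta(\theta_k^* )$ for all $k\in\{0,\dots,n-1\}$. Stationary point of DP: $\pi=(\theta_0^*,\dots,\theta_{n-1}^* )\in\Theta^n$ such that for all $k\in\{0,\dots,n-1\}$ and all $x\in\mathbb{R}^N$, $-\nabla_{\theta_k}Q_k^\pi(x,\mu_{\theta_k^*}(x))\in\mathcal{N}_\Theta(\theta_k^* )$, where $\nabla_{\theta_k}Q_k^\pi(x,\mu_{\theta_k^*}(x))$ is the gradient (understood to exist) of $\theta\mapsto Q_k^\pi(x,\mu_\theta(x))$ at $\theta=\theta_k^*$. *)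

theory Defs
  imports "HOL-Analysis.Analysis"
begin

definition twice_continuously_differentiable ::
  "('a::real_normed_vector \<Rightarrow> 'b::real_normed_vector) \<Rightarrow> bool" where
  "twice_continuously_differentiable f \<longleftrightarrow>
     (\<exists>(f' :: 'a \<Rightarrow> 'a \<Rightarrow>\<^sub>L 'b) (f'' :: 'a \<Rightarrow> 'a \<Rightarrow>\<^sub>L 'a \<Rightarrow>\<^sub>L 'b).
        (\<forall>z. (f has_derivative blinfun_apply (f' z)) (at z)) \<and>
        (\<forall>z. (f' has_derivative blinfun_apply (f'' z)) (at z)) \<and>
        continuous_on UNIV f'')"

text \<open>
  The regular (Frechet) normal cone: the vectors \<open>v\<close> such that
  \<open>v \<bullet> (s - s0) \<le> o(norm (s - s0))\<close> as \<open>s\<close> tends to \<open>s0\<close> in \<open>S\<close>. It is meant for \<open>s0 \<in> S\<close>.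
\<close>

definition normal_cone :: "'a::real_inner set \<Rightarrow> 'a \<Rightarrow> 'a set" where
  "normal_cone S s0 =
     {v. \<forall>\<epsilon>>0. \<exists>\<delta>>0. \<forall>s\<in>S. norm (s - s0) < \<delta> \<longrightarrow> v \<bullet> (s - s0) \<le> \<epsilon> * norm (s - s0)}"

text \<open>
  Parameters used below: horizon \<open>n\<close>, dynamics \<open>f k x u\<close>, stage costs \<open>c k x u\<close> for \<open>k < n\<close>,
  terminal cost \<open>cT\<close> (the cost at time \<open>n\<close>), policy family \<open>\<mu> \<theta> x\<close>, and a policy parameter
  vector \<open>\<pi>\<close>, of which only \<open>\<pi> 0, \<dots>, \<pi> (n - 1)\<close> matter.
\<close>

function cost_to_go ::
  "nat \<Rightarrow> (nat \<Rightarrow> 'x \<Rightarrow> 'u \<Rightarrow> 'x) \<Rightarrow> (nat \<Rightarrow> 'x \<Rightarrow> 'u \<Rightarrow> real) \<Rightarrow> ('x \<Rightarrow> real) \<Rightarrow>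
   ('p \<Rightarrow> 'x \<Rightarrow> 'u) \<Rightarrow> (nat \<Rightarrow> 'p) \<Rightarrow> nat \<Rightarrow> 'x \<Rightarrow> real" where
  "cost_to_go n f c cT \<mu> \<pi> k x =
     (if k < n
      then c k x (\<mu> (\<pi> k) x) + cost_to_go n f c cT \<mu> \<pi> (Suc k) (f k x (\<mu> (\<pi> k) x))
      else cT x)"
  by pat_completeness auto
termination
  by (relation "Wellfounded.measure (\<lambda>(n, _, _, _, _, _, k, _). n - k)") auto

declare cost_to_go.simps [simp del]

definition Q_factor ::
  "nat \<Rightarrow> (nat \<Rightarrow> 'x \<Rightarrow> 'u \<Rightarrow> 'x) \<Rightarrow> (nat \<Rightarrow> 'x \<Rightarrow> 'u \<Rightarrow> real) \<Rightarrow> ('x \<Rightarrow> real) \<Rightarrow>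
   ('p \<Rightarrow> 'x \<Rightarrow> 'u) \<Rightarrow> (nat \<Rightarrow> 'p) \<Rightarrow> nat \<Rightarrow> 'x \<Rightarrow> 'u \<Rightarrow> real" where
  "Q_factor n f c cT \<mu> \<pi> k x u = c k x u + cost_to_go n f c cT \<mu> \<pi> (Suc k) (f k x u)"

lemma cost_to_go_terminal: "cost_to_go n f c cT \<mu> \<pi> n x = cT x"
  by (simp add: cost_to_go.simps)

lemma cost_to_go_eq_Q_factor:
  "k < n \<Longrightarrow> cost_to_go n f c cT \<mu> \<pi> k x = Q_factor n f c cT \<mu> \<pi> k x (\<mu> (\<pi> k) x)"
  by (subst cost_to_go.simps) (simp add: Q_factor_def)

text \<open>
  Gradients are gradients in the ambient Euclidean space of the parameters, also at points that
  are not interior to \<open>\<Theta>\<close>; hence \<open>\<mu>\<close> takes parameters from the whole space, and for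
  non-open \<open>\<Theta>\<close> its values near \<open>\<Theta>\<close> are those of the extension used to take gradients.
  Stationarity includes the existence of the gradient, which is then unique.
\<close>

definition one_shot_stationary ::
  "nat \<Rightarrow> (nat \<Rightarrow> 'x \<Rightarrow> 'u \<Rightarrow> 'x) \<Rightarrow> (nat \<Rightarrow> 'x \<Rightarrow> 'u \<Rightarrow> real) \<Rightarrow> ('x \<Rightarrow> real) \<Rightarrow>
   ('p::real_inner) set \<Rightarrow> ('p \<Rightarrow> 'x \<Rightarrow> 'u) \<Rightarrow> 'x \<Rightarrow> (nat \<Rightarrow> 'p) \<Rightarrow> bool" where
  "one_shot_stationary n f c cT \<Theta> \<mu> x0 \<pi> \<longleftrightarrow>
     (\<forall>k<n. \<pi> k \<in> \<Theta>) \<and>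
     (\<forall>k<n. \<exists>g. GDERIV (\<lambda>\<theta>. cost_to_go n f c cT \<mu> (\<pi>(k := \<theta>)) 0 x0) (\<pi> k) :> g \<and>
                - g \<in> normal_cone \<Theta> (\<pi> k))"

definition DP_stationary ::
  "nat \<Rightarrow> (nat \<Rightarrow> 'x \<Rightarrow> 'u \<Rightarrow> 'x) \<Rightarrow> (nat \<Rightarrow> 'x \<Rightarrow> 'u \<Rightarrow> real) \<Rightarrow> ('x \<Rightarrow> real) \<Rightarrow>
   ('p::real_inner) set \<Rightarrow> ('p \<Rightarrow> 'x \<Rightarrow> 'u) \<Rightarrow> (nat \<Rightarrow> 'p) \<Rightarrow> bool" where
  "DP_stationary n f c cT \<Theta> \<mu> \<pi> \<longleftrightarrow>
     (\<forall>k<n. \<pi> k \<in> \<Theta>) \<and>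
     (\<forall>k<n. \<forall>x. \<exists>g. GDERIV (\<lambda>\<theta>. Q_factor n f c cT \<mu> \<pi> k x (\<mu> \<theta> x)) (\<pi> k) :> g \<and>
                    - g \<in> normal_cone \<Theta> (\<pi> k))"

text \<open>
  The partial derivative of \<open>\<mu>\<close> in the parameter exists near \<open>(x, \<theta>)\<close> and is jointly continuous
  there; no differentiability in the state is required.
\<close>

definition cont_diff_in_param_near ::
  "('p::real_normed_vector \<Rightarrow> 'x::topological_space \<Rightarrow> 'u::real_normed_vector) \<Rightarrow>
   'x \<Rightarrow> 'p \<Rightarrow> bool" where
  "cont_diff_in_param_near \<mu> x \<theta> \<longleftrightarrow>
     (\<exists>(U :: ('x \<times> 'p) set) (D :: 'x \<times> 'p \<Rightarrow> 'p \<Rightarrow>\<^sub>L 'u).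
        open U \<and> (x, \<theta>) \<in> U \<and>
        (\<forall>(y, \<eta>)\<in>U. ((\<lambda>\<theta>'. \<mu> \<theta>' y) has_derivative blinfun_apply (D (y, \<eta>))) (at \<eta>)) \<and>
        continuous_on U D)"

end

theory Submission
  imports Defs
begin

text \<open>
  Along the nominal trajectory, perturbing only the parameter of stage \<open>k\<close> changes neither the
  states \<open>xs 0, \<dots>, xs k\<close> nor the costs before stage \<open>k\<close>, and does not change the cost-to-go
  function of stage \<open>k + 1\<close>. Hence the one-shot cost, as a function of that parameter, is a constant plus
  the Q-factor of stage \<open>k\<close> at \<open>xs k\<close>, and the two gradients coincide.
\<close>

text \<open>The recursion from stage \<open>k\<close> only looks up parameters at stages
  \<open>k\<close>, ..., \<open>n - 1\<close>.\<close>

lemma cost_to_go_cong: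
  assumes "\<And>i. k \<le> i \<Longrightarrow> i < n \<Longrightarrow> \<pi> i = \<pi>' i"
  shows "cost_to_go n f c cT \<mu> \<pi> k x = cost_to_go n f c cT \<mu> \<pi>' k x"
  using assms
\<comment> \<open>Induction on the number of remaining stages, as the recursion raises
  \<open>k\<close>; \<open>x\<close> is arbitrary because the next state differs.\<close>
proof (induction "n - k" arbitrary: k x)
  case 0
  then show ?case by (simp add: cost_to_go.simps)
next
  case (Suc m)
  have "cost_to_go n f c cT \<mu> \<pi> (Suc k) y = cost_to_go n f c cT \<mu> \<pi>' (Suc k) y" for y
    using Suc.hyps Suc.prems by simp
  then show ?case
    using Suc.prems by (subst (1 2) cost_to_go.simps) auto
qed

text \<open>Unrolls the first \<open>k\<close> stages. The dynamics are assumed only below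
  \<open>k\<close>, so the lemma still applies after the parameter of stage \<open>k\<close> is
  changed.\<close>

lemma cost_to_go_along_trajectory:
  assumes "\<And>i. i < k \<Longrightarrow> xs (Suc i) = f i (xs i) (\<mu> (\<pi> i) (xs i))" and "k \<le> n"
  shows "cost_to_go n f c cT \<mu> \<pi> 0 (xs 0) =
    (\<Sum>i<k. c i (xs i) (\<mu> (\<pi> i) (xs i))) + cost_to_go n f c cT \<mu> \<pi> k (xs k)"
  using assms
proof (induction k)
  case (Suc k)
  then show ?case
    by (simp add: cost_to_go_eq_Q_factor Q_factor_def)
qed simp

lemma cost_to_go_update_eq_Q_factor:
  assumes "\<And>i. i < k \<Longrightarrow> xs (Suc i) = f i (xs i) (\<mu> (\<pi> i) (xs i))" and "k < n"
  shows "cost_to_go n f c cT \<mu> (\<pi>(k := \<theta>)) 0 (xs 0) =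
    (\<Sum>i<k. c i (xs i) (\<mu> (\<pi> i) (xs i))) + Q_factor n f c cT \<mu> \<pi> k (xs k) (\<mu> \<theta> (xs k))"
proof -
  \<comment> \<open>The tail starts after the modified stage, so \<open>\<theta>\<close> enters only
    through the action at stage \<open>k\<close>.\<close>
  have "cost_to_go n f c cT \<mu> (\<pi>(k := \<theta>)) (Suc k) y = cost_to_go n f c cT \<mu> \<pi> (Suc k) y" for y
    by (rule cost_to_go_cong) simp
  then have "cost_to_go n f c cT \<mu> (\<pi>(k := \<theta>)) k (xs k) =
      Q_factor n f c cT \<mu> \<pi> k (xs k) (\<mu> \<theta> (xs k))"
    using \<open>k < n\<close> by (simp add: cost_to_go_eq_Q_factor Q_factor_def)
  moreover have "cost_to_go n f c cT \<mu> (\<pi>(k := \<theta>)) 0 (xs 0) =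
      (\<Sum>i<k. c i (xs i) (\<mu> ((\<pi>(k := \<theta>)) i) (xs i))) +
      cost_to_go n f c cT \<mu> (\<pi>(k := \<theta>)) k (xs k)"
    using assms by (intro cost_to_go_along_trajectory) auto
  ultimately show ?thesis by simp
qed

theorem theorem5:
  fixes n :: nat
    and A :: "(real^'M) set"
    and f :: "nat \<Rightarrow> real^'N \<Rightarrow> real^'M \<Rightarrow> real^'N"
    and c :: "nat \<Rightarrow> real^'N \<Rightarrow> real^'M \<Rightarrow> real"
    and cT :: "real^'N \<Rightarrow> real"
    and \<Theta> :: "('p::euclidean_space) set"
    and \<mu> :: "'p \<Rightarrow> real^'N \<Rightarrow> real^'M"
    and \<pi> :: "nat \<Rightarrow> 'p"
    and x0 :: "real^'N"
    and xs :: "nat \<Rightarrow> real^'N"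
  assumes compact_actions: "compact A"
    and dynamics_C2: "\<And>k. k < n \<Longrightarrow> twice_continuously_differentiable (\<lambda>(x, u). f k x u)"
    and stage_cost_C2: "\<And>k. k < n \<Longrightarrow> twice_continuously_differentiable (\<lambda>(x, u). c k x u)"
    and terminal_cost_C2: "twice_continuously_differentiable cT"
    and policy_into: "\<And>\<theta> x. \<theta> \<in> \<Theta> \<Longrightarrow> \<mu> \<theta> x \<in> A"
    and policy_bounded: "\<And>\<theta>. \<theta> \<in> \<Theta> \<Longrightarrow> bounded (range (\<mu> \<theta>))"
    and policy_uniformly_continuous:
      "\<forall>\<epsilon>>0. \<exists>\<delta>>0. \<forall>\<theta>\<in>\<Theta>. \<forall>\<theta>'\<in>\<Theta>. norm (\<theta> - \<theta>') < \<delta> \<longrightarrow>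
         (SUP x. norm (\<mu> \<theta> x - \<mu> \<theta>' x)) < \<epsilon>"
    and DP_stationary: "DP_stationary n f c cT \<Theta> \<mu> \<pi>"
    and initial_state: "xs 0 = x0"
    and state_sequence: "\<And>k. k < n \<Longrightarrow> xs (Suc k) = f k (xs k) (\<mu> (\<pi> k) (xs k))"
    and policy_C1: "\<And>k. k < n \<Longrightarrow> cont_diff_in_param_near \<mu> (xs k) (\<pi> k)"
  shows "one_shot_stationary n f c cT \<Theta> \<mu> x0 \<pi>"
  unfolding one_shot_stationary_def
proof (intro conjI allI impI)
  fix k assume "k < n"
  then show "\<pi> k \<in> \<Theta>"
    using DP_stationary by (simp add: DP_stationary_def)
next
  fix k assume k: "k < n"
  \<comment> \<open>DP stationarity holds at every state; it is used at \<open>xs k\<close>, the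
    state that \<open>\<pi>\<close> reaches from \<open>x0\<close>.\<close>
  then obtain g where
    g: "GDERIV (\<lambda>\<theta>. Q_factor n f c cT \<mu> \<pi> k (xs k) (\<mu> \<theta> (xs k))) (\<pi> k) :> g"
    and cone: "- g \<in> normal_cone \<Theta> (\<pi> k)"
    using DP_stationary unfolding DP_stationary_def by blast
  have "(\<lambda>\<theta>. cost_to_go n f c cT \<mu> (\<pi>(k := \<theta>)) 0 x0) =
      (\<lambda>\<theta>. (\<Sum>i<k. c i (xs i) (\<mu> (\<pi> i) (xs i))) +
        Q_factor n f c cT \<mu> \<pi> k (xs k) (\<mu> \<theta> (xs k)))"
    using k state_sequence cost_to_go_update_eq_Q_factor[of k xs f \<mu> \<pi> n c cT]
    by (simp add: fun_eq_iff flip: initial_state)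
  \<comment> \<open>The sum is constant in \<open>\<theta>\<close>, so existence and value of the
    gradient both carry over.\<close>
  moreover have "GDERIV (\<lambda>\<theta>. (\<Sum>i<k. c i (xs i) (\<mu> (\<pi> i) (xs i))) +
        Q_factor n f c cT \<mu> \<pi> k (xs k) (\<mu> \<theta> (xs k))) (\<pi> k) :> g"
    using GDERIV_add[OF GDERIV_const g] by simp
  ultimately show "\<exists>g. GDERIV (\<lambda>\<theta>. cost_to_go n f c cT \<mu> (\<pi>(k := \<theta>)) 0 x0) (\<pi> k) :> g \<and>
      - g \<in> normal_cone \<Theta> (\<pi> k)"
    using cone by auto
qed

end
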